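(* For $z\in\mathbb{C}$ and $q\in\mathbb{C}$ with $|q|<1$, \[ \sum_{n\geq 0}(-1)^{n} q^{4n^2} \frac{(q^2,-q^4;q^4)_{n}}{(q^4;q^4)_{2n}} \left(1 - \frac{q^{4n+1}z}{1+q^{4n+2}} \right) z^{2n} = (zq, -zq^3;q^4)_\infty . \]
   Context: $q$-Pochhammer notation: $(a;q)_n=\prod_{j=0}^{n-1}(1-aq^j)$ for $n\ge 1$, $(a;q)_0=1$, $(a;q)_\infty=\prod_{j\ge 0}(1-aq^j)$, and $(a_1,\dots,a_k;q)_n=(a_1;q)_n\cdots(a_k;q)_n$ (also for $n=\infty$). *)

theory Defs
  imports "HOL-Analysis.Analysis"
begin

definition qpoch :: "complex \<Rightarrow> complex \<Rightarrow> nat \<Rightarrow> complex" where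
  "qpoch a q n = (\<Prod>j<n. 1 - a * q ^ j)"

(* For norm q < 1 the product converges in the sense of has_prod, which allows
   finitely many vanishing factors (the value is then 0). *)
definition qpoch_inf :: "complex \<Rightarrow> complex \<Rightarrow> complex" where
  "qpoch_inf a q = (\<Prod>j. 1 - a * q ^ j)"

end

theory Submission
  imports Defs
begin

text \<open>
  Both sides equal 1 at z = 0 and satisfy F(z) = (1 - z q) (1 + z q^3) F(z q^4). For the series
  this holds because the coefficients solve the three-term recurrence that the functional equation
  imposes, so the partial sums satisfy it up to a boundary term that tends to 0. Iterating the
  functional equation and using continuity at 0 identifies the series with the product.
\<close>

section \<open>Nonvanishing and convergence of q-Pochhammer products\<close>

lemma one_minus_power_nonzero:
  fixes q :: complex
  assumes "norm q < 1" "0 < n"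
  shows "1 - q ^ n \<noteq> 0" "1 + q ^ n \<noteq> 0"
proof -
  have "norm (q ^ n) < 1"
    using assms by (simp add: norm_power power_less_one_iff)
  then show "1 - q ^ n \<noteq> 0" "1 + q ^ n \<noteq> 0"
    by (auto simp: add_eq_0_iff dest: arg_cong[of _ _ norm])
qed

lemma qpoch_Suc: "qpoch a q (Suc n) = qpoch a q n * (1 - a * q ^ n)"
  by (simp add: qpoch_def)

text \<open>With \<open>k = 4\<close> this covers the denominators of the series, so dividing by
  them is genuine division.\<close>

lemma qpoch_power_self_nonzero:
  fixes q :: complex
  assumes "norm q < 1" "0 < k"
  shows "qpoch (q ^ k) (q ^ k) n \<noteq> 0"
proof -
  have "1 - q ^ k * (q ^ k) ^ j \<noteq> 0" for j
    using one_minus_power_nonzero(1)[OF assms(1), of "k * Suc j"] assms(2)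
    by (simp add: power_mult power_add)
  then show ?thesis
    by (simp add: qpoch_def)
qed

lemma qpoch_LIMSEQ:
  fixes a q :: complex
  assumes "norm q < 1"
  shows "(\<lambda>n. qpoch a q n) \<longlonglongrightarrow> qpoch_inf a q"
proof -
  have "summable (\<lambda>j. norm ((1 - a * q ^ j) - 1))"
    using assms by (simp add: norm_mult norm_power summable_mult summable_geometric)
  then have "convergent_prod (\<lambda>j. 1 - a * q ^ j)"
    by (intro abs_convergent_prod_imp_convergent_prod summable_imp_abs_convergent_prod)
  then have "(\<lambda>n. \<Prod>j\<le>n. 1 - a * q ^ j) \<longlonglongrightarrow> qpoch_inf a q"
    unfolding qpoch_inf_def by (simp add: convergent_prod_LIMSEQ)
  \<comment> \<open>The limit theorem for infinite products includes the factor with index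
    \<open>n\<close>, while \<open>qpoch\<close> stops before it; hence the index shift.\<close>
  then show ?thesis
    unfolding qpoch_def lessThan_Suc_atMost[symmetric] by (rule LIMSEQ_imp_Suc)
qed

text \<open>Coefficient ratios tending to 0 give an infinite radius of convergence, by the ratio
  test with constant 1/2.\<close>

lemma summable_powser_ratio_tendsto_0:
  fixes a r :: "nat \<Rightarrow> complex"
  assumes "\<And>n. a (Suc n) = r n * a n" "r \<longlonglongrightarrow> 0"
  shows "summable (\<lambda>n. a n * w ^ n)"
proof -
  have "(\<lambda>n. norm (r n * w)) \<longlonglongrightarrow> 0"
    using assms(2) by (intro tendsto_norm_zero tendsto_mult_left_zero)
  then have "\<forall>\<^sub>F n in sequentially. norm (r n * w) < 1 / 2"
    by (rule order_tendstoD) simp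
  then obtain N where N: "\<And>n. n \<ge> N \<Longrightarrow> norm (r n * w) < 1 / 2"
    by (auto simp: eventually_sequentially)
  show ?thesis
  proof (rule summable_ratio_test[of "1 / 2" N])
    fix n assume "n \<ge> N"
    have "norm (a (Suc n) * w ^ Suc n) = norm (r n * w) * norm (a n * w ^ n)"
      by (simp add: assms(1) norm_mult norm_power mult_ac)
    also have "\<dots> \<le> 1 / 2 * norm (a n * w ^ n)"
      using N[OF \<open>n \<ge> N\<close>] by (intro mult_right_mono) auto
    finally show "norm (a (Suc n) * w ^ Suc n) \<le> 1 / 2 * norm (a n * w ^ n)" .
  qed simp
qed

section \<open>Coefficients of the series and their recurrences\<close>

definition even_coeff :: "complex \<Rightarrow> nat \<Rightarrow> complex" where
  "even_coeff q n = (- 1) ^ n * q ^ (4 * n\<^sup>2)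
     * (qpoch (q ^ 2) (q ^ 4) n * qpoch (- (q ^ 4)) (q ^ 4) n / qpoch (q ^ 4) (q ^ 4) (2 * n))"

text \<open>The coefficient of \<open>z ^ (2 * n + 1)\<close> in the series is the negative of this.\<close>
definition odd_coeff :: "complex \<Rightarrow> nat \<Rightarrow> complex" where
  "odd_coeff q n = q ^ (4 * n + 1) / (1 + q ^ (4 * n + 2)) * even_coeff q n"

lemma even_coeff_0 [simp]: "even_coeff q 0 = 1"
  by (simp add: even_coeff_def qpoch_def)

text \<open>The denominator gains \<open>1 - q ^ (8 * n + 4)\<close> and
  \<open>1 - q ^ (8 * n + 8)\<close>. Each is a difference of squares, and one factor of each
  cancels against a new factor of the numerator.\<close>

lemma even_coeff_Suc:
  fixes q :: complex
  assumes "norm q < 1"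
  shows "even_coeff q (Suc n)
       = - (q ^ (8 * n + 4)) / ((1 - q ^ (4 * n + 4)) * (1 + q ^ (4 * n + 2))) * even_coeff q n"
proof -
  define x where "x = q ^ (4 * n)"
  have x: "q ^ (4 * n + k) = x * q ^ k" "q ^ (8 * n + k) = x\<^sup>2 * q ^ k" for k
    by (simp_all add: x_def power_add power_mult[symmetric])
  have nz: "1 - x * q ^ 4 \<noteq> 0" "1 + x * q ^ 4 \<noteq> 0" "1 - x * q\<^sup>2 \<noteq> 0" "1 + x * q\<^sup>2 \<noteq> 0"
    using one_minus_power_nonzero[OF assms, of "4 * n + 4", unfolded x]
      one_minus_power_nonzero[OF assms, of "4 * n + 2", unfolded x] by simp_all
  have x': "(q ^ 4) ^ n = x" "(q ^ 4) ^ (2 * n) = x\<^sup>2"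
    by (simp_all add: x_def power_mult[symmetric])
  have sq: "q ^ (4 * (Suc n)\<^sup>2) = q ^ (4 * n\<^sup>2) * (x\<^sup>2 * q ^ 4)"
    by (simp add: x_def power_mult[symmetric] power_add[symmetric] power2_eq_square algebra_simps)
  have "(1 - q ^ 4 * x\<^sup>2) * (1 - q ^ 4 * (q ^ 4 * x\<^sup>2))
      = (1 - x * q\<^sup>2) * (1 + x * q\<^sup>2) * ((1 - x * q ^ 4) * (1 + x * q ^ 4))"
    by algebra
  moreover have "2 * Suc n = Suc (Suc (2 * n))"
    by simp
  ultimately have den: "qpoch (q ^ 4) (q ^ 4) (2 * Suc n) = qpoch (q ^ 4) (q ^ 4) (2 * n)
      * ((1 - x * q\<^sup>2) * (1 + x * q\<^sup>2) * ((1 - x * q ^ 4) * (1 + x * q ^ 4)))"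
    by (simp only: qpoch_Suc power_Suc x' mult.assoc)
  have num: "qpoch (q ^ 2) (q ^ 4) (Suc n) = qpoch (q ^ 2) (q ^ 4) n * (1 - x * q\<^sup>2)"
    "qpoch (- (q ^ 4)) (q ^ 4) (Suc n) = qpoch (- (q ^ 4)) (q ^ 4) n * (1 + x * q ^ 4)"
    by (simp_all add: qpoch_Suc x' mult.commute)
  \<comment> \<open>Here \<open>c\<close> and \<open>d\<close> stand for the cancelling factors
    \<open>1 - x * q ^ 2\<close> and \<open>1 + x * q ^ 4\<close>.\<close>
  have cancel: "(- 1 * s) * (r * t) * ((u * c) * (v * d) / (w * (c * e * (f * d))))
      = - t / (f * e) * (s * r * (u * v / w))"
    if "c \<noteq> 0" "d \<noteq> 0" for c d e f r s t u v w :: complex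
    using that by (simp add: mult_ac)
  show ?thesis
    unfolding even_coeff_def sq den num x power_Suc
    by (rule cancel[OF nz(3,2)])
qed

text \<open>Clearing denominators, here and in the next lemma, reduces the recurrences to polynomial
  identities within reach of \<open>algebra\<close>.\<close>

lemma odd_coeff_mult:
  fixes q :: complex
  assumes "norm q < 1"
  shows "odd_coeff q n * (1 + q ^ (4 * n + 2)) = q ^ (4 * n + 1) * even_coeff q n"
  using one_minus_power_nonzero(2)[OF assms, of "4 * n + 2"] by (simp add: odd_coeff_def)

lemma even_coeff_Suc_mult:
  fixes q :: complex
  assumes "norm q < 1"
  shows "even_coeff q (Suc n) * (1 - q ^ (4 * n + 4)) * (1 + q ^ (4 * n + 2))
       = - (q ^ (8 * n + 4)) * even_coeff q n"
  using one_minus_power_nonzero(1)[OF assms, of "4 * n + 4"]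
    one_minus_power_nonzero(2)[OF assms, of "4 * n + 2"]
  by (simp add: even_coeff_Suc[OF assms])

text \<open>
  The next two identities compare the coefficients of \<open>z ^ m\<close>, for even and for odd \<open>m\<close>, in
  \<open>F z = (1 - z * q) * (1 + z * q ^ 3) * F (z * q ^ 4)\<close>.
\<close>

lemma even_coeff_recurrence:
  fixes q :: complex
  assumes "norm q < 1"
  shows "even_coeff q (Suc n) * (1 - q ^ (8 * n + 8))
       = - (q ^ (8 * n + 4)) * (even_coeff q n + (q ^ 3 - q) * odd_coeff q n)"
proof -
  define x a a' b where "x = q ^ (4 * n)" and "a = even_coeff q n" and "a' = even_coeff q (Suc n)"
    and "b = odd_coeff q n"
  have x: "q ^ (4 * n + k) = x * q ^ k" "q ^ (8 * n + k) = x\<^sup>2 * q ^ k" for k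
    by (simp_all add: x_def power_add power_mult[symmetric])
  have nz: "1 + x * q\<^sup>2 \<noteq> 0"
    using one_minus_power_nonzero(2)[OF assms, of "4 * n + 2", unfolded x] by simp
  have a': "a' * (1 - x * q ^ 4) * (1 + x * q\<^sup>2) = - (x\<^sup>2 * q ^ 4) * a"
    using even_coeff_Suc_mult[OF assms, of n] unfolding x a_def a'_def .
  have b: "b * (1 + x * q\<^sup>2) = x * q * a"
    using odd_coeff_mult[OF assms, of n] unfolding x a_def b_def by simp
  \<comment> \<open>The identity is proved after multiplication by the nonzero factor
    \<open>1 + x * q ^ 2\<close>, which lets \<open>a'\<close> and \<open>b\<close> both be traded
    for \<open>a\<close>.\<close>
  have "a' * (1 - x\<^sup>2 * q ^ 8) * (1 + x * q\<^sup>2)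
      = (1 + x * q ^ 4) * (a' * (1 - x * q ^ 4) * (1 + x * q\<^sup>2))"
    by algebra
  also have "\<dots> = - (x\<^sup>2 * q ^ 4) * (a * (1 + x * q\<^sup>2) + (q ^ 3 - q) * (x * q * a))"
    unfolding a' by algebra
  also have "\<dots> = - (x\<^sup>2 * q ^ 4) * (a + (q ^ 3 - q) * b) * (1 + x * q\<^sup>2)"
    unfolding b[symmetric] by algebra
  finally show ?thesis
    unfolding x a_def a'_def b_def by (rule mult_right_cancel[OF nz, THEN iffD1])
qed

lemma odd_coeff_recurrence:
  fixes q :: complex
  assumes "norm q < 1"
  shows "odd_coeff q (Suc n) * (1 - q ^ (8 * n + 12))
       = - (q ^ (8 * n + 8)) * ((q ^ 3 - q) * even_coeff q (Suc n) + odd_coeff q n)"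
proof -
  define x a a' b where "x = q ^ (4 * n)" and "a = even_coeff q n" and "a' = even_coeff q (Suc n)"
    and "b = odd_coeff q n"
  have x: "q ^ (4 * n + k) = x * q ^ k" "q ^ (8 * n + k) = x\<^sup>2 * q ^ k" for k
    by (simp_all add: x_def power_add power_mult[symmetric])
  have nz: "1 + x * q\<^sup>2 \<noteq> 0"
    using one_minus_power_nonzero(2)[OF assms, of "4 * n + 2", unfolded x] by simp
  have a': "a' * (1 - x * q ^ 4) * (1 + x * q\<^sup>2) = - (x\<^sup>2 * q ^ 4) * a"
    using even_coeff_Suc_mult[OF assms, of n] unfolding x a_def a'_def .
  have b: "b * (1 + x * q\<^sup>2) = x * q * a"
    using odd_coeff_mult[OF assms, of n] unfolding x a_def b_def by simp
  define b' where "b' = odd_coeff q (Suc n)"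
  have shift: "4 * Suc n + k = 4 * n + (k + 4)" for k
    by simp
  have b': "b' * (1 + x * q ^ 6) = x * q ^ 5 * a'"
    using odd_coeff_mult[OF assms, of "Suc n"] unfolding shift x a'_def b'_def by simp
  have "x\<^sup>2 * q ^ 8 * b * (1 + x * q\<^sup>2) = - (x * q ^ 5) * (- (x\<^sup>2 * q ^ 4) * a)"
    unfolding mult.assoc b by algebra
  also have "\<dots> = - (x * q ^ 5) * (1 - x * q ^ 4) * a' * (1 + x * q\<^sup>2)"
    unfolding a'[symmetric] by algebra
  \<comment> \<open>Eliminating \<open>a\<close> expresses \<open>b\<close> through
    \<open>a'\<close>, as \<open>b'\<close> already is, so the recurrence becomes an identity in
    \<open>a'\<close> alone.\<close>
  finally have b_a': "x\<^sup>2 * q ^ 8 * b = - (x * q ^ 5) * (1 - x * q ^ 4) * a'"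
    by (rule mult_right_cancel[OF nz, THEN iffD1])
  have "b' * (1 - x\<^sup>2 * q ^ 12) = (1 - x * q ^ 6) * (b' * (1 + x * q ^ 6))"
    by algebra
  also have "\<dots> = - (x\<^sup>2 * q ^ 8) * (q ^ 3 - q) * a' - (- (x * q ^ 5) * (1 - x * q ^ 4) * a')"
    unfolding b' by algebra
  also have "\<dots> = - (x\<^sup>2 * q ^ 8) * ((q ^ 3 - q) * a' + b)"
    unfolding b_a'[symmetric] by algebra
  finally show ?thesis
    unfolding x a_def a'_def b_def b'_def .
qed

section \<open>Functional equation for the partial sums\<close>

definition series_term :: "complex \<Rightarrow> complex \<Rightarrow> nat \<Rightarrow> complex" where
  "series_term q z n = (even_coeff q n - z * odd_coeff q n) * (z\<^sup>2) ^ n"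

text \<open>Up to degree \<open>2 * N + 1\<close> in \<open>z\<close> the coefficients agree by the
  recurrences. The quadratic factor also creates terms of degrees \<open>2 * N + 2\<close> and
  \<open>2 * N + 3\<close>, and the last summand removes exactly these.\<close>

lemma sum_series_term_functional_eq:
  fixes q z :: complex
  assumes "norm q < 1"
  shows "(\<Sum>n\<le>N. series_term q z n)
       = (1 - z * q) * (1 + z * q ^ 3) * (\<Sum>n\<le>N. series_term q (z * q ^ 4) n)
         + (q ^ 8) ^ N * q ^ 4 * z\<^sup>2 * (z\<^sup>2) ^ N
           * (even_coeff q N + (q ^ 3 - q - z * q ^ 4) * odd_coeff q N)"
proof (induction N)
  case 0
  define b where "b = odd_coeff q 0"
  have "b * (1 + q\<^sup>2) = q"
    using odd_coeff_mult[OF assms, of 0] by (simp add: b_def power2_eq_square)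
  moreover have "b * (1 - q ^ 4) = (b * (1 + q\<^sup>2)) * (1 - q\<^sup>2)" "q - q ^ 3 = q * (1 - q\<^sup>2)"
    by algebra+
  \<comment> \<open>This compares the coefficients of \<open>z\<close> itself, the one nontrivial
    degree below the range of the recurrences.\<close>
  ultimately have b: "q - q ^ 3 = b * (1 - q ^ 4)"
    by simp
  have "(1 - z * q) * (1 + z * q ^ 3) * (1 - z * q ^ 4 * b)
      + q ^ 4 * z\<^sup>2 * (1 + (q ^ 3 - q - z * q ^ 4) * b) = 1 - z * (q - q ^ 3) - z * q ^ 4 * b"
    by algebra
  also have "\<dots> = 1 - z * b"
    unfolding b by algebra
  finally show ?case
    by (simp add: series_term_def b_def)
next
  case (Suc N)
  define x where "x = (q ^ 8) ^ N"
  define y where "y = (z\<^sup>2) ^ N"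
  have pw: "((z * q ^ 4)\<^sup>2) ^ Suc N = x * y * q ^ 8 * z\<^sup>2" "(z\<^sup>2) ^ Suc N = y * z\<^sup>2"
    "(q ^ 8) ^ Suc N = x * q ^ 8"
    by (simp_all add: x_def y_def power_mult_distrib power_mult[symmetric] mult_ac)
  have x: "q ^ (8 * N + k) = x * q ^ k" for k
    by (simp add: x_def power_add power_mult)
  define a a' b b' where "a = even_coeff q N" and "a' = even_coeff q (Suc N)"
    and "b = odd_coeff q N" and "b' = odd_coeff q (Suc N)"
  note defs = x_def[symmetric] y_def[symmetric] a_def[symmetric] a'_def[symmetric]
    b_def[symmetric] b'_def[symmetric]
  have ev: "x * q ^ 4 * (a + (q ^ 3 - q) * b) = - a' * (1 - x * q ^ 8)"
    using even_coeff_recurrence[OF assms, of N] unfolding x defs by simp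
  have "b' * (1 - x * q ^ 12) = - (x * q ^ 8) * ((q ^ 3 - q) * a' + b)"
    using odd_coeff_recurrence[OF assms, of N] unfolding x defs .
  then have od: "x * q ^ 8 * b = - b' * (1 - x * q ^ 12) - x * q ^ 8 * (q ^ 3 - q) * a'"
    by (simp add: algebra_simps)
  \<comment> \<open>The old boundary term is split by parity of the degree in \<open>z\<close>, so
    that \<open>ev\<close> and \<open>od\<close> turn it into the new boundary term plus the
    difference of the two new summands.\<close>
  have "x * q ^ 4 * z\<^sup>2 * y * (a + (q ^ 3 - q - z * q ^ 4) * b)
      = z\<^sup>2 * y * (x * q ^ 4 * (a + (q ^ 3 - q) * b) - z * (x * q ^ 8 * b))"
    by algebra
  also have "\<dots> = (1 - z * q) * (1 + z * q ^ 3) * ((a' - z * q ^ 4 * b') * (x * y * q ^ 8 * z\<^sup>2))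
      + x * q ^ 8 * q ^ 4 * z\<^sup>2 * (y * z\<^sup>2) * (a' + (q ^ 3 - q - z * q ^ 4) * b')
      - (a' - z * b') * (y * z\<^sup>2)"
    unfolding ev od by algebra
  finally show ?case
    unfolding sum.atMost_Suc Suc.IH series_term_def[of _ _ "Suc N"] pw defs
    by (simp add: distrib_left)
qed

section \<open>Convergence of the series\<close>

lemma summable_even_coeff:
  fixes q w :: complex
  assumes "norm q < 1"
  shows "summable (\<lambda>n. even_coeff q n * w ^ n)"
proof (rule summable_powser_ratio_tendsto_0)
  show "even_coeff q (Suc n)
      = - (q ^ (8 * n + 4)) / ((1 - q ^ (4 * n + 4)) * (1 + q ^ (4 * n + 2))) * even_coeff q n" for n
    by (rule even_coeff_Suc[OF assms])
  have lim: "(\<lambda>n. q ^ (k * n + m)) \<longlonglongrightarrow> 0" if "k > 0" for k m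
    by (rule filterlim_compose[OF LIMSEQ_power_zero[OF assms]])
       (use that in \<open>auto intro!: filterlim_subseq strict_monoI\<close>)
  show "(\<lambda>n. - (q ^ (8 * n + 4)) / ((1 - q ^ (4 * n + 4)) * (1 + q ^ (4 * n + 2)))) \<longlonglongrightarrow> 0"
    by (rule tendsto_eq_intros lim refl | simp)+
qed

text \<open>The factor relating \<open>odd_coeff\<close> to \<open>even_coeff\<close> tends to 0,
  hence is bounded, and comparison applies.\<close>

lemma summable_odd_coeff:
  fixes q w :: complex
  assumes "norm q < 1"
  shows "summable (\<lambda>n. odd_coeff q n * w ^ n)"
proof -
  have lim: "(\<lambda>n. q ^ (4 * n + m)) \<longlonglongrightarrow> 0" for m
    using LIMSEQ_power_zero[OF assms]
    by (rule filterlim_compose) (auto intro!: filterlim_subseq strict_monoI)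
  have "(\<lambda>n. q ^ (4 * n + 1) / (1 + q ^ (4 * n + 2))) \<longlonglongrightarrow> 0"
    by (rule tendsto_eq_intros lim refl | simp)+
  then have "Bseq (\<lambda>n. q ^ (4 * n + 1) / (1 + q ^ (4 * n + 2)))"
    by (intro convergent_imp_Bseq convergentI)
  then obtain K where K: "\<And>n. norm (q ^ (4 * n + 1) / (1 + q ^ (4 * n + 2))) \<le> K"
    by (auto simp: Bseq_def)
  \<comment> \<open>Convergence at a point of larger modulus, \<open>norm w + 1\<close>, gives
    absolute convergence at \<open>w\<close>.\<close>
  have "summable (\<lambda>n. norm (even_coeff q n * w ^ n))"
    by (rule powser_insidea[OF summable_even_coeff[OF assms, of "of_real (norm w + 1)"]]) simp
  then have "summable (\<lambda>n. K * norm (even_coeff q n * w ^ n))"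
    by (rule summable_mult)
  then show ?thesis
  proof (rule summable_comparison_test[rotated], intro exI allI impI)
    fix n
    show "norm (odd_coeff q n * w ^ n) \<le> K * norm (even_coeff q n * w ^ n)"
      unfolding odd_coeff_def mult.assoc[of _ _ "w ^ n"] norm_mult[of _ "even_coeff q n * w ^ n"]
      by (rule mult_right_mono[OF K norm_ge_zero])
  qed
qed

text \<open>Separating even and odd parts leaves two power series in the square of \<open>z\<close>,
  from which continuity can be read off.\<close>

definition series_sum :: "complex \<Rightarrow> complex \<Rightarrow> complex" where
  "series_sum q z = (\<Sum>n. even_coeff q n * (z\<^sup>2) ^ n) - z * (\<Sum>n. odd_coeff q n * (z\<^sup>2) ^ n)"

lemma series_term_sums:
  fixes q z :: complex
  assumes "norm q < 1"
  shows "series_term q z sums series_sum q z"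
proof -
  have "(\<lambda>n. even_coeff q n * (z\<^sup>2) ^ n - z * (odd_coeff q n * (z\<^sup>2) ^ n)) sums series_sum q z"
    unfolding series_sum_def
    by (intro sums_diff sums_mult summable_sums summable_even_coeff summable_odd_coeff assms)
  moreover have "series_term q z = (\<lambda>n. even_coeff q n * (z\<^sup>2) ^ n - z * (odd_coeff q n * (z\<^sup>2) ^ n))"
    by (simp add: fun_eq_iff series_term_def algebra_simps)
  ultimately show ?thesis
    by simp
qed

section \<open>Passage to the limit and the product formula\<close>

lemma series_sum_functional_eq:
  fixes q z :: complex
  assumes "norm q < 1"
  shows "series_sum q z = (1 - z * q) * (1 + z * q ^ 3) * series_sum q (z * q ^ 4)"
proof (rule LIMSEQ_unique)
  show "(\<lambda>N. \<Sum>n\<le>N. series_term q z n) \<longlonglongrightarrow> series_sum q z"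
    using series_term_sums[OF assms] by (simp add: sums_def_le)
  have S: "(\<lambda>N. \<Sum>n\<le>N. series_term q (z * q ^ 4) n) \<longlonglongrightarrow> series_sum q (z * q ^ 4)"
    using series_term_sums[OF assms] by (simp add: sums_def_le)
  have e: "(\<lambda>N. even_coeff q N * (z\<^sup>2) ^ N) \<longlonglongrightarrow> 0"
    and o: "(\<lambda>N. odd_coeff q N * (z\<^sup>2) ^ N) \<longlonglongrightarrow> 0"
    by (intro summable_LIMSEQ_zero summable_even_coeff summable_odd_coeff assms)+
  have p: "(\<lambda>N. (q ^ 8) ^ N) \<longlonglongrightarrow> 0"
    using assms by (intro LIMSEQ_power_zero) (simp add: norm_power power_less_one_iff)
  \<comment> \<open>The boundary term is regrouped so that each coefficient meets its power of
    \<open>z\<close>: these products are terms of convergent series and tend to 0.\<close>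
  have "(\<lambda>N. (1 - z * q) * (1 + z * q ^ 3) * (\<Sum>n\<le>N. series_term q (z * q ^ 4) n)
       + (q ^ 8) ^ N * q ^ 4 * z\<^sup>2 * (even_coeff q N * (z\<^sup>2) ^ N
           + (q ^ 3 - q - z * q ^ 4) * (odd_coeff q N * (z\<^sup>2) ^ N)))
     \<longlonglongrightarrow> (1 - z * q) * (1 + z * q ^ 3) * series_sum q (z * q ^ 4)"
    by (rule tendsto_eq_intros S e o p refl | simp)+
  then show "(\<lambda>N. \<Sum>n\<le>N. series_term q z n)
     \<longlonglongrightarrow> (1 - z * q) * (1 + z * q ^ 3) * series_sum q (z * q ^ 4)"
    unfolding sum_series_term_functional_eq[OF assms, of z] by (simp add: algebra_simps)
qed

lemma series_sum_iterate:
  fixes q z :: complex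
  assumes "norm q < 1"
  shows "series_sum q z
       = qpoch (z * q) (q ^ 4) N * qpoch (- (z * q ^ 3)) (q ^ 4) N * series_sum q (z * (q ^ 4) ^ N)"
proof (induction N)
  case 0
  then show ?case by (simp add: qpoch_def)
next
  case (Suc N)
  show ?case
    by (subst Suc.IH, subst series_sum_functional_eq[OF assms])
       (simp add: qpoch_Suc algebra_simps)
qed

text \<open>Both parts are everywhere convergent power series composed with squaring.\<close>

lemma isCont_series_sum:
  fixes q z :: complex
  assumes "norm q < 1"
  shows "isCont (series_sum q) z"
proof -
  have "isCont (\<lambda>z. \<Sum>n. c n * (z\<^sup>2) ^ n) z" if "\<And>w. summable (\<lambda>n. c n * w ^ n)"
    for c :: "nat \<Rightarrow> complex"
    by (rule isCont_o2[OF _ isCont_powser_converges_everywhere[OF that]]) (intro continuous_intros)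
  from this[OF summable_even_coeff[OF assms]] this[OF summable_odd_coeff[OF assms]]
  show ?thesis
    unfolding series_sum_def[abs_def] by (intro isCont_diff isCont_mult continuous_ident)
qed

lemma series_sum_eq_qpoch_inf:
  fixes q z :: complex
  assumes "norm q < 1"
  shows "series_sum q z = qpoch_inf (z * q) (q ^ 4) * qpoch_inf (- (z * q ^ 3)) (q ^ 4)"
proof (rule LIMSEQ_unique)
  have q4: "norm (q ^ 4) < 1"
    using assms by (simp add: norm_power power_less_one_iff)
  have "(\<lambda>N. z * (q ^ 4) ^ N) \<longlonglongrightarrow> 0"
    by (intro tendsto_mult_right_zero LIMSEQ_power_zero q4)
  then have "(\<lambda>N. series_sum q (z * (q ^ 4) ^ N)) \<longlonglongrightarrow> series_sum q 0"
    by (rule isCont_tendsto_compose[OF isCont_series_sum[OF assms]])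
  moreover have "series_sum q 0 = 1"
    by (simp add: series_sum_def)
  ultimately have "(\<lambda>N. qpoch (z * q) (q ^ 4) N * qpoch (- (z * q ^ 3)) (q ^ 4) N
        * series_sum q (z * (q ^ 4) ^ N))
      \<longlonglongrightarrow> qpoch_inf (z * q) (q ^ 4) * qpoch_inf (- (z * q ^ 3)) (q ^ 4) * 1"
    by (intro tendsto_mult qpoch_LIMSEQ q4) simp
  \<comment> \<open>By \<open>series_sum_iterate\<close> the sequence above is constantly
    \<open>series_sum q z\<close>, so its limit is that value.\<close>
  then show "(\<lambda>N. series_sum q z)
      \<longlonglongrightarrow> qpoch_inf (z * q) (q ^ 4) * qpoch_inf (- (z * q ^ 3)) (q ^ 4)"
    by (simp flip: series_sum_iterate[OF assms])
qed simp

theorem theorem1p1: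
  fixes z q :: complex
  assumes "norm q < 1"
  shows "(\<lambda>n::nat. (- 1) ^ n * q ^ (4 * n\<^sup>2)
            * (qpoch (q ^ 2) (q ^ 4) n * qpoch (- (q ^ 4)) (q ^ 4) n / qpoch (q ^ 4) (q ^ 4) (2 * n))
            * (1 - q ^ (4 * n + 1) * z / (1 + q ^ (4 * n + 2))) * z ^ (2 * n))
         sums (qpoch_inf (z * q) (q ^ 4) * qpoch_inf (- (z * q ^ 3)) (q ^ 4))"
proof -
  have "series_term q z = (\<lambda>n. even_coeff q n
      * (1 - q ^ (4 * n + 1) * z / (1 + q ^ (4 * n + 2))) * z ^ (2 * n))"
    unfolding series_term_def odd_coeff_def power_mult[of z 2]
    by (simp add: right_diff_distrib mult_ac)
  then show ?thesis
    using series_term_sums[OF assms, of z]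
    by (simp only: even_coeff_def series_sum_eq_qpoch_inf[OF assms])
qed

end
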